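(* If $(U,R,\mathcal F)$ is an L-approximation space, then the dcpo $(\mathfrak C(U,R,\mathcal F),\subseteq)$ of its CF-closed sets is an L-domain.
   Context: Upper approximation: for a set $U$, a binary relation $R$ on $U$ and $A\subseteq U$, put $\overline R(A)=\{x\in U\mid \exists y\in A,\ xRy\}$. $K\subseteq_{fin}X$ means that $K$ is a finite (possibly empty) subset of $X$, and $\mathcal P_{fin}(U)$ is the set of all finite subsets of $U$. CF-approximation space: a triple $(U,R,\mathcal F)$ with $R$ a transitive relation on the set $U$ and $\emptyset\neq\mathcal F\subseteq\mathcal P_{fin}(U)$ such that for every $F\in\mathcal F$ and every $K\subseteq_{fin}\overline R(F)$ there is $G\in\mathcal F$ with $K\subseteq\overline R(G)$ and $G\subseteq\overline R(F)$. CF-closed set: $E\subseteq U$ such that for every $K\subseteq_{fin}E$ there is $F\in\mathcal F$ with $K\subseteq\overline R(F)\subseteq E$ and $F\subseteq E$. $\mathfrak C(U,R,\mathcal F)$ is the set of all CF-closed sets; ordered by inclusion it is a dcpo. Join saturation: $\mathcal F^{\sharp}$ is the set of all unions $\bigcup\mathcal A$ of nonempty finite subfamilies $\mathcal A\subseteq\mathcal F$. L-approximation space: a CF-approximation space $(U,R,\mathcal F)$ such that for all $M\in\mathcal F^{\sharp}\cup\{\emptyset\}$ and $F\in\mathcal F$ with $M\subseteq\overline R(F)$ there is $G\in\mathcal F$ satisfying: (sL-1) $\overline R(M)\subseteq\overline R(G)\subseteq\overline R(F)$; and (sL-2) for all $G'\in\mathcal F$, $\overline R(M)\subseteq\overline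 R(G')\subseteq\overline R(F)$ implies $\overline R(G)\subseteq\overline R(G')$. Domains: directed sets are nonempty; a dcpo is a poset in which every directed subset has a supremum. $x\ll y$ means that for every directed $D$ having a supremum with $\sup D\geqslant y$ there is $d\in D$ with $x\leqslant d$. A continuous domain is a dcpo in which, for every $x$, the set $\{y\mid y\ll x\}$ is directed with supremum $x$. An L-domain is a continuous domain $L$ such that for every $x\in L$ the principal ideal ${\downarrow}x=\{y\in L\mid y\leqslant x\}$, with the inherited order, is a complete lattice (L-domains need not have a least element). *)

theory Defs
  imports "HOL-Algebra.Complete_Lattice"
begin

section \<open>Domains\<close>

definition directed_in :: "('a, 'b) gorder_scheme \<Rightarrow> 'a set \<Rightarrow> bool" where
  "directed_in L D \<longleftrightarrow> D \<subseteq> carrier L \<and> D \<noteq> {} \<and>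
     (\<forall>x\<in>D. \<forall>y\<in>D. \<exists>z\<in>D. x \<sqsubseteq>\<^bsub>L\<^esub> z \<and> y \<sqsubseteq>\<^bsub>L\<^esub> z)"

definition way_below :: "('a, 'b) gorder_scheme \<Rightarrow> 'a \<Rightarrow> 'a \<Rightarrow> bool" where
  "way_below L x y \<longleftrightarrow> x \<in> carrier L \<and> y \<in> carrier L \<and>
     (\<forall>D s. directed_in L D \<and> is_lub L s D \<and> y \<sqsubseteq>\<^bsub>L\<^esub> s \<longrightarrow> (\<exists>d\<in>D. x \<sqsubseteq>\<^bsub>L\<^esub> d))"

locale dcpo = partial_order L for L (structure) +
  assumes directed_sup_exists: "directed_in L D \<Longrightarrow> \<exists>s. is_lub L s D"

locale continuous_domain = dcpo L for L (structure) +
  assumes way_below_directed: "x \<in> carrier L \<Longrightarrow> directed_in L {y. way_below L y x}"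
    and way_below_sup: "x \<in> carrier L \<Longrightarrow> is_lub L x {y. way_below L y x}"

locale L_domain = continuous_domain L for L (structure) +
  assumes principal_ideal_complete_lattice:
    "x \<in> carrier L \<Longrightarrow> complete_lattice (L\<lparr>carrier := {y \<in> carrier L. y \<sqsubseteq>\<^bsub>L\<^esub> x}\<rparr>)"

section \<open>CF-approximation spaces and L-approximation spaces\<close>

definition upper_approx :: "'a set \<Rightarrow> 'a rel \<Rightarrow> 'a set \<Rightarrow> 'a set" where
  "upper_approx U R A = {x \<in> U. \<exists>y\<in>A. (x, y) \<in> R}"

locale CF_approximation_space =
  fixes U :: "'a set" and R :: "'a rel" and \<F> :: "'a set set"
  assumes rel_on: "R \<subseteq> U \<times> U"
    and trans_rel: "trans R"
    and family_nonempty: "\<F> \<noteq> {}"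
    and family_finite_subsets: "\<F> \<subseteq> {F. finite F \<and> F \<subseteq> U}"
    and interpolation: "\<lbrakk>F \<in> \<F>; finite K; K \<subseteq> upper_approx U R F\<rbrakk> \<Longrightarrow>
      \<exists>G\<in>\<F>. K \<subseteq> upper_approx U R G \<and> G \<subseteq> upper_approx U R F"

definition CF_closed :: "'a set \<Rightarrow> 'a rel \<Rightarrow> 'a set set \<Rightarrow> 'a set \<Rightarrow> bool" where
  "CF_closed U R \<F> E \<longleftrightarrow> E \<subseteq> U \<and>
     (\<forall>K. finite K \<and> K \<subseteq> E \<longrightarrow>
       (\<exists>F\<in>\<F>. K \<subseteq> upper_approx U R F \<and> upper_approx U R F \<subseteq> E \<and> F \<subseteq> E))"

definition CF_closed_order :: "'a set \<Rightarrow> 'a rel \<Rightarrow> 'a set set \<Rightarrow> 'a set gorder" where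
  "CF_closed_order U R \<F> = \<lparr>carrier = {E. CF_closed U R \<F> E}, eq = (=), le = (\<subseteq>)\<rparr>"

definition join_saturation :: "'a set set \<Rightarrow> 'a set set" where
  "join_saturation \<F> = {\<Union>\<A> |\<A>. \<A> \<subseteq> \<F> \<and> finite \<A> \<and> \<A> \<noteq> {}}"

locale L_approximation_space = CF_approximation_space U R \<F>
  for U :: "'a set" and R :: "'a rel" and \<F> :: "'a set set" +
  assumes sL: "\<lbrakk>M \<in> join_saturation \<F> \<union> {{}}; F \<in> \<F>; M \<subseteq> upper_approx U R F\<rbrakk> \<Longrightarrow>
      \<exists>G\<in>\<F>. upper_approx U R M \<subseteq> upper_approx U R G \<and>
              upper_approx U R G \<subseteq> upper_approx U R F \<and>
              (\<forall>G'\<in>\<F>. upper_approx U R M \<subseteq> upper_approx U R G' \<and>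
                         upper_approx U R G' \<subseteq> upper_approx U R F \<longrightarrow>
                         upper_approx U R G \<subseteq> upper_approx U R G')"

end

(* The sets upper_approx U R F with F in the family form a basis: F \<subseteq> E makes
   upper_approx U R F way below E, and every closed E is the directed union of these sets.
   For suprema inside the principal ideal of E, let M \<subseteq> E be a finite union of members of
   the family.  The least G provided by (sL) for M below F does not depend on F \<subseteq> E,
   because any two such F have a common upper bound; hence upper_approx U R G contains
   upper_approx U R M and lies in every closed t \<subseteq> E with M \<subseteq> t.  The supremum of an
   arbitrary S is then the directed union of these sets, M ranging over the finite unions
   of members of the family that are contained in elements of S. *)
theory Submission
  imports Defs
begin

section \<open>Families of sets ordered by inclusion\<close>

abbreviation inclusion_order :: "'a set set \<Rightarrow> 'a set gorder" where
  "inclusion_order C \<equiv> \<lparr>carrier = C, eq = (=), le = (\<subseteq>)\<rparr>"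

lemma partial_order_inclusion: "partial_order (inclusion_order C)"
  by unfold_locales auto

lemma is_lub_inclusion_iff:
  assumes "S \<subseteq> C"
  shows "is_lub (inclusion_order C) s S \<longleftrightarrow>
    s \<in> C \<and> (\<forall>x\<in>S. x \<subseteq> s) \<and> (\<forall>t\<in>C. (\<forall>x\<in>S. x \<subseteq> t) \<longrightarrow> s \<subseteq> t)"
  using assms by (simp add: least_def Upper_def subset_iff) blast

lemma is_glb_inclusion_iff:
  assumes "S \<subseteq> C"
  shows "is_glb (inclusion_order C) s S \<longleftrightarrow>
    s \<in> C \<and> (\<forall>x\<in>S. s \<subseteq> x) \<and> (\<forall>t\<in>C. (\<forall>x\<in>S. t \<subseteq> x) \<longrightarrow> t \<subseteq> s)"
  using assms by (simp add: greatest_def Lower_def subset_iff) blast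

text \<open>Infima come for free as suprema of sets of lower bounds. Since \<open>S\<close> may be
  empty or all of \<open>C\<close>, bottom and top are included.\<close>

lemma complete_lattice_inclusionI:
  assumes sups: "\<And>S. S \<subseteq> C \<Longrightarrow> \<exists>s. is_lub (inclusion_order C) s S"
  shows "complete_lattice (inclusion_order C)"
proof -
  interpret partial_order "inclusion_order C"
    by (rule partial_order_inclusion)
  show ?thesis
  proof unfold_locales
    fix S assume "S \<subseteq> carrier (inclusion_order C)"
    then have S: "S \<subseteq> C" by simp
    show "\<exists>s. is_lub (inclusion_order C) s S" using sups S .
    obtain s where "is_lub (inclusion_order C) s {t \<in> C. \<forall>x\<in>S. t \<subseteq> x}"
      using sups[of "{t \<in> C. \<forall>x\<in>S. t \<subseteq> x}"] by auto
    then have s: "s \<in> C" "\<And>t. t \<in> C \<Longrightarrow> \<forall>x\<in>S. t \<subseteq> x \<Longrightarrow> t \<subseteq> s"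
      and least: "\<And>t. t \<in> C \<Longrightarrow> \<forall>x\<in>{t \<in> C. \<forall>x\<in>S. t \<subseteq> x}. x \<subseteq> t \<Longrightarrow> s \<subseteq> t"
      by (subst (asm) is_lub_inclusion_iff; blast)+
    \<comment> \<open>Each \<open>x\<close> in \<open>S\<close> is itself an upper bound of the set
      of lower bounds, so the least upper bound \<open>s\<close> stays below it.\<close>
    have "s \<subseteq> x" if "x \<in> S" for x
      using least[of x] S that by blast
    with s show "\<exists>i. is_glb (inclusion_order C) i S"
      by (subst is_glb_inclusion_iff[OF S]) blast
  qed
qed

lemma finite_subset_directed_Union:
  assumes "finite K" "K \<subseteq> \<Union>D" "D \<noteq> {}"
    and "\<forall>x\<in>D. \<forall>y\<in>D. \<exists>z\<in>D. x \<subseteq> z \<and> y \<subseteq> z"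
  shows "\<exists>d\<in>D. K \<subseteq> d"
  using assms(1,2)
proof (induction K)
  case empty
  then show ?case using assms(3) by auto
next
  case (insert k K)
  then obtain d e where "d \<in> D" "K \<subseteq> d" "e \<in> D" "k \<in> e" by auto
  moreover then obtain z where "z \<in> D" "d \<subseteq> z" "e \<subseteq> z" using assms(4) by blast
  ultimately show ?case by blast
qed

section \<open>The domain of closed sets\<close>

lemma upper_approx_mono: "A \<subseteq> B \<Longrightarrow> upper_approx U R A \<subseteq> upper_approx U R B"
  unfolding upper_approx_def by auto

context CF_approximation_space
begin

abbreviation up :: "'a set \<Rightarrow> 'a set" where
  "up \<equiv> upper_approx U R"

abbreviation closed :: "'a set \<Rightarrow> bool" where
  "closed \<equiv> CF_closed U R \<F>"

text \<open>Transitivity collapses two steps of \<open>R\<close> into one. This makes it enough to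
  place the generators inside \<open>up B\<close>.\<close>

lemma up_least: "A \<subseteq> up B \<Longrightarrow> up A \<subseteq> up B"
proof
  fix x assume "A \<subseteq> up B" "x \<in> up A"
  then obtain y z where "x \<in> U" "(x, y) \<in> R" "(y, z) \<in> R" "z \<in> B"
    unfolding upper_approx_def by blast
  then show "x \<in> up B"
    using transD[OF trans_rel] unfolding upper_approx_def by blast
qed

lemma finite_member: "F \<in> \<F> \<Longrightarrow> finite F"
  using family_finite_subsets by auto

text \<open>Interpolation supplies everything except \<open>up G \<subseteq> up F\<close>, which
  follows from \<open>G \<subseteq> up F\<close> by transitivity.\<close>

lemma closed_up:
  assumes "F \<in> \<F>"
  shows "closed (up F)"
  unfolding CF_closed_def
proof (intro conjI allI impI)
  show "up F \<subseteq> U" unfolding upper_approx_def by auto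
  fix K assume "finite K \<and> K \<subseteq> up F"
  then obtain G where "G \<in> \<F>" "K \<subseteq> up G" "G \<subseteq> up F"
    using interpolation[OF assms] by blast
  then show "\<exists>G\<in>\<F>. K \<subseteq> up G \<and> up G \<subseteq> up F \<and> G \<subseteq> up F"
    using up_least by blast
qed

lemma closed_approximate:
  assumes "closed E" "finite K" "K \<subseteq> E"
  shows "\<exists>F\<in>\<F>. K \<subseteq> up F \<and> up F \<subseteq> E \<and> F \<subseteq> E"
  using assms unfolding CF_closed_def by blast

text \<open>Members of the family are finite, so closedness can be applied to the finite set
  \<open>F1 \<union> F2\<close>. This is the source of directedness, and later of common
  bounds.\<close>

lemma closed_approximate2:
  assumes "closed E" "F1 \<in> \<F>" "F1 \<subseteq> E" "F2 \<in> \<F>" "F2 \<subseteq> E"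
  shows "\<exists>F\<in>\<F>. F \<subseteq> E \<and> up F1 \<subseteq> up F \<and> up F2 \<subseteq> up F"
proof -
  have "finite (F1 \<union> F2)" "F1 \<union> F2 \<subseteq> E"
    using assms(2-5) by (simp_all add: finite_member)
  then obtain F where F: "F \<in> \<F>" "F1 \<union> F2 \<subseteq> up F" "F \<subseteq> E"
    using closed_approximate[OF assms(1), of "F1 \<union> F2"] by blast
  show ?thesis
    by (rule bexI[of _ F]) (use F in \<open>simp_all add: up_least\<close>)
qed

text \<open>Closedness speaks only of members of the family; an arbitrary finite \<open>A\<close> is
  first covered by some \<open>up F\<close> inside \<open>E\<close>.\<close>

lemma up_subset_closed:
  assumes "closed E" "finite A" "A \<subseteq> E"
  shows "up A \<subseteq> E"
proof -
  obtain F where "A \<subseteq> up F" "up F \<subseteq> E"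
    using closed_approximate[OF assms] by blast
  then show ?thesis using up_least[of A F] by blast
qed

lemma up_member_subset:
  assumes "closed E" "F \<in> \<F>" "F \<subseteq> E"
  shows "up F \<subseteq> E"
  using up_subset_closed[OF assms(1) finite_member[OF assms(2)] assms(3)] .

text \<open>By directedness a finite subset of the union already lies in one \<open>d\<close>, and a
  witness for \<open>d\<close> serves for the union.\<close>

lemma closed_directed_Union:
  assumes "\<forall>d\<in>D. closed d" "D \<noteq> {}"
    and "\<forall>x\<in>D. \<forall>y\<in>D. \<exists>z\<in>D. x \<subseteq> z \<and> y \<subseteq> z"
  shows "closed (\<Union>D)"
  unfolding CF_closed_def
proof (intro conjI allI impI)
  show "\<Union>D \<subseteq> U" using assms(1) unfolding CF_closed_def by auto
  fix K assume "finite K \<and> K \<subseteq> \<Union>D"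
  then obtain d where "d \<in> D" "K \<subseteq> d" "finite K"
    using finite_subset_directed_Union[OF _ _ assms(2,3), of K] by blast
  moreover then obtain F where "F \<in> \<F>" "K \<subseteq> up F" "up F \<subseteq> d" "F \<subseteq> d"
    using closed_approximate[of d K] assms(1) by blast
  ultimately show "\<exists>F\<in>\<F>. K \<subseteq> up F \<and> up F \<subseteq> \<Union>D \<and> F \<subseteq> \<Union>D"
    by blast
qed

section \<open>Directed suprema and the way-below relation on closed sets\<close>

abbreviation \<CC> :: "'a set gorder" where
  "\<CC> \<equiv> CF_closed_order U R \<F>"

lemma CF_closed_order_eq: "\<CC> = inclusion_order (Collect closed)"
  unfolding CF_closed_order_def by simp

lemma carrier_iff: "E \<in> carrier \<CC> \<longleftrightarrow> closed E"
  and le_iff: "E \<sqsubseteq>\<^bsub>\<CC>\<^esub> E' \<longleftrightarrow> E \<subseteq> E'"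
  unfolding CF_closed_order_def by simp_all

lemma is_lub_iff:
  assumes "\<And>x. x \<in> S \<Longrightarrow> closed x"
  shows "is_lub \<CC> s S \<longleftrightarrow>
    closed s \<and> (\<forall>x\<in>S. x \<subseteq> s) \<and> (\<forall>t. closed t \<longrightarrow> (\<forall>x\<in>S. x \<subseteq> t) \<longrightarrow> s \<subseteq> t)"
  unfolding CF_closed_order_eq using assms by (subst is_lub_inclusion_iff) auto

lemma directed_in_iff:
  "directed_in \<CC> D \<longleftrightarrow> (\<forall>d\<in>D. closed d) \<and> D \<noteq> {} \<and>
    (\<forall>x\<in>D. \<forall>y\<in>D. \<exists>z\<in>D. x \<subseteq> z \<and> y \<subseteq> z)"
  unfolding directed_in_def CF_closed_order_def by auto

lemma directed_lub_iff:
  assumes "directed_in \<CC> D"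
  shows "is_lub \<CC> s D \<longleftrightarrow> s = \<Union>D"
proof -
  have cl: "\<And>d. d \<in> D \<Longrightarrow> closed d" and Un: "closed (\<Union>D)"
    using assms closed_directed_Union[of D] unfolding directed_in_iff by simp_all
  have lub: "is_lub \<CC> s D \<longleftrightarrow>
      closed s \<and> \<Union>D \<subseteq> s \<and> (\<forall>t. closed t \<longrightarrow> \<Union>D \<subseteq> t \<longrightarrow> s \<subseteq> t)"
    unfolding Sup_le_iff by (rule is_lub_iff) (rule cl)
  show ?thesis
  proof
    assume "is_lub \<CC> s D"
    then have "\<Union>D \<subseteq> s" "s \<subseteq> \<Union>D" unfolding lub using Un by simp_all
    then show "s = \<Union>D" by simp
  next
    assume "s = \<Union>D"
    then show "is_lub \<CC> s D" unfolding lub using Un by simp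
  qed
qed

text \<open>This is compactness: the finite set \<open>F\<close> lies in the union of
  \<open>D\<close>, hence in a single closed \<open>d\<close>, which then contains
  \<open>up F\<close>.\<close>

lemma way_below_upI:
  assumes "closed E" "F \<in> \<F>" "F \<subseteq> E"
  shows "way_below \<CC> (up F) E"
  unfolding way_below_def carrier_iff le_iff
proof (intro conjI allI impI)
  fix D s assume *: "directed_in \<CC> D \<and> is_lub \<CC> s D \<and> E \<subseteq> s"
  then have "s = \<Union>D" using directed_lub_iff[of D s] by blast
  then have "F \<subseteq> \<Union>D" using assms(3) * by auto
  moreover have D: "\<forall>d\<in>D. closed d" "D \<noteq> {}" "\<forall>x\<in>D. \<forall>y\<in>D. \<exists>z\<in>D. x \<subseteq> z \<and> y \<subseteq> z"
    using * unfolding directed_in_iff by simp_all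
  ultimately obtain d where d: "d \<in> D" "F \<subseteq> d"
    using finite_subset_directed_Union[OF finite_member[OF assms(2)] _ D(2,3)] by blast
  then show "\<exists>d\<in>D. up F \<subseteq> d"
    using up_member_subset[OF _ assms(2) d(2)] D(1) by blast
qed (simp_all add: assms closed_up)

lemma directed_in_approximants:
  assumes "closed E"
  shows "directed_in \<CC> {up F | F. F \<in> \<F> \<and> F \<subseteq> E}"
  unfolding directed_in_iff
proof (intro conjI ballI)
  show "{up F | F. F \<in> \<F> \<and> F \<subseteq> E} \<noteq> {}"
    \<comment> \<open>Approximating the empty set yields a member of the family inside
      \<open>E\<close>, even when \<open>E\<close> is empty.\<close>
    using closed_approximate[OF assms, of "{}"] by blast
next
  fix x y assume "x \<in> {up F | F. F \<in> \<F> \<and> F \<subseteq> E}" "y \<in> {up F | F. F \<in> \<F> \<and> F \<subseteq> E}"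
  then obtain F1 F2 where F: "F1 \<in> \<F>" "F1 \<subseteq> E" "F2 \<in> \<F>" "F2 \<subseteq> E"
    and eq: "x = up F1" "y = up F2"
    by blast
  show "\<exists>z\<in>{up F | F. F \<in> \<F> \<and> F \<subseteq> E}. x \<subseteq> z \<and> y \<subseteq> z"
    unfolding eq using closed_approximate2[OF assms F] by blast
qed (use closed_up in blast)

lemma Union_approximants:
  assumes "closed E"
  shows "\<Union>{up F | F. F \<in> \<F> \<and> F \<subseteq> E} = E"
proof
  show "\<Union>{up F | F. F \<in> \<F> \<and> F \<subseteq> E} \<subseteq> E"
    using up_member_subset[OF assms] by blast
  show "E \<subseteq> \<Union>{up F | F. F \<in> \<F> \<and> F \<subseteq> E}"
  proof
    fix x assume "x \<in> E"
    then obtain F where "F \<in> \<F>" "{x} \<subseteq> up F" "F \<subseteq> E"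
      using closed_approximate[OF assms, of "{x}"] by blast
    then show "x \<in> \<Union>{up F | F. F \<in> \<F> \<and> F \<subseteq> E}" by blast
  qed
qed

lemma way_below_iff:
  assumes "closed E"
  shows "way_below \<CC> X E \<longleftrightarrow> closed X \<and> (\<exists>F\<in>\<F>. F \<subseteq> E \<and> X \<subseteq> up F)"
proof
  assume X: "way_below \<CC> X E"
  \<comment> \<open>The way-below hypothesis is tested on the directed family of approximants, whose
    supremum is \<open>E\<close>.\<close>
  have "is_lub \<CC> E {up F | F. F \<in> \<F> \<and> F \<subseteq> E}"
    using directed_lub_iff[OF directed_in_approximants] Union_approximants assms by simp
  then have "\<exists>d\<in>{up F | F. F \<in> \<F> \<and> F \<subseteq> E}. X \<subseteq> d"
    using X directed_in_approximants[OF assms] unfolding way_below_def le_iff by blast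
  then show "closed X \<and> (\<exists>F\<in>\<F>. F \<subseteq> E \<and> X \<subseteq> up F)"
    using X unfolding way_below_def carrier_iff by blast
next
  assume "closed X \<and> (\<exists>F\<in>\<F>. F \<subseteq> E \<and> X \<subseteq> up F)"
  then show "way_below \<CC> X E"
    using way_below_upI[OF assms] unfolding way_below_def carrier_iff le_iff
    by (meson subset_trans)
qed

lemma continuous_domain_closed: "continuous_domain \<CC>"
proof -
  interpret partial_order \<CC>
    unfolding CF_closed_order_eq by (rule partial_order_inclusion)
  have dir: "directed_in \<CC> {y. way_below \<CC> y E}" if E: "closed E" for E
    unfolding directed_in_iff
  proof (intro conjI ballI)
    show "{y. way_below \<CC> y E} \<noteq> {}"
      using way_below_upI[OF E] directed_in_approximants[OF E]
      unfolding directed_in_iff by blast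
  next
    fix x y assume "x \<in> {y. way_below \<CC> y E}" "y \<in> {y. way_below \<CC> y E}"
    then obtain F1 F2 where
      F: "F1 \<in> \<F>" "F1 \<subseteq> E" "x \<subseteq> up F1" "F2 \<in> \<F>" "F2 \<subseteq> E" "y \<subseteq> up F2"
      using way_below_iff[OF E] by auto
    then obtain G where "G \<in> \<F>" "G \<subseteq> E" "up F1 \<subseteq> up G" "up F2 \<subseteq> up G"
      using closed_approximate2[OF E, of F1 F2] by blast
    then show "\<exists>z\<in>{y. way_below \<CC> y E}. x \<subseteq> z \<and> y \<subseteq> z"
      using way_below_upI[OF E] F by (intro bexI[of _ "up G"]) auto
  qed (use that in \<open>auto simp: way_below_def carrier_iff\<close>)
  have "\<Union>{y. way_below \<CC> y E} = E" if E: "closed E" for E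
  proof
    show "\<Union>{y. way_below \<CC> y E} \<subseteq> E"
      using way_below_iff[OF E] up_member_subset[OF E] by blast
    show "E \<subseteq> \<Union>{y. way_below \<CC> y E}"
      using Union_approximants[OF E] way_below_upI[OF E] by blast
  qed
  then show ?thesis
    by unfold_locales (use dir directed_lub_iff carrier_iff in auto)
qed

section \<open>Joins in principal ideals\<close>

text \<open>The bound is required to be \<open>up F\<close> with \<open>F \<subseteq> E\<close> since \<open>up G \<subseteq> E\<close> alone does not
  place \<open>up G\<close> below such a set.\<close>

definition bounded_cover :: "'a set \<Rightarrow> 'a set \<Rightarrow> 'a set \<Rightarrow> bool" where
  "bounded_cover E M G \<longleftrightarrow> G \<in> \<F> \<and> up M \<subseteq> up G \<and> (\<exists>F\<in>\<F>. F \<subseteq> E \<and> up G \<subseteq> up F)"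

text \<open>Minimality concerns \<open>up G\<close> only: \<open>up G\<close> is determined by
  \<open>E\<close> and \<open>M\<close>, while \<open>G\<close> itself need not be.\<close>

definition least_cover :: "'a set \<Rightarrow> 'a set \<Rightarrow> 'a set \<Rightarrow> bool" where
  "least_cover E M G \<longleftrightarrow>
    bounded_cover E M G \<and> (\<forall>G'. bounded_cover E M G' \<longrightarrow> up G \<subseteq> up G')"

text \<open>A bounded cover of the larger set also covers the smaller one. This makes the least
  covers of a growing family directed.\<close>

lemma least_cover_mono:
  assumes "least_cover E M G" "least_cover E M' G'" "M \<subseteq> M'"
  shows "up G \<subseteq> up G'"
proof -
  have "bounded_cover E M G'"
    using assms(2) upper_approx_mono[OF assms(3), of U R]
    unfolding least_cover_def bounded_cover_def by blast
  then show ?thesis using assms(1) unfolding least_cover_def by blast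
qed

end

section \<open>Least covers from (sL) and suprema of arbitrary subfamilies\<close>

context L_approximation_space
begin

lemma least_cover_exists:
  assumes E: "closed E" and \<A>: "finite \<A>" "\<A> \<subseteq> \<F>" and ME: "\<Union>\<A> \<subseteq> E"
  shows "\<exists>G. least_cover E (\<Union>\<A>) G"
proof -
  define M where "M = \<Union>\<A>"
  have M: "M \<in> join_saturation \<F> \<union> {{}}"
    using \<A> unfolding M_def join_saturation_def by blast
  have "finite M" using \<A> finite_member unfolding M_def by blast
  then obtain F where F: "F \<in> \<F>" "M \<subseteq> up F" "F \<subseteq> E"
    using closed_approximate[OF E, of M] ME unfolding M_def by blast
  then obtain G where G: "G \<in> \<F>" "up M \<subseteq> up G" "up G \<subseteq> up F"
    "\<forall>G'\<in>\<F>. up M \<subseteq> up G' \<and> up G' \<subseteq> up F \<longrightarrow> up G \<subseteq> up G'"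
    using sL[OF M F(1,2)] by blast
  \<comment> \<open>\<open>G\<close> is least only below \<open>up F\<close>, while
    \<open>G'\<close> may be bounded by a different \<open>up F'\<close>; both are compared below a
    common \<open>up H\<close>.\<close>
  have "up G \<subseteq> up G'" if G': "bounded_cover E M G'" for G'
  proof -
    obtain F' where F': "F' \<in> \<F>" "F' \<subseteq> E" "up G' \<subseteq> up F'"
      using G' unfolding bounded_cover_def by blast
    obtain H where H: "H \<in> \<F>" "up F \<subseteq> up H" "up F' \<subseteq> up H"
      using closed_approximate2[OF E F(1,3) F'(1,2)] by blast
    have "M \<subseteq> up H" using F(2) H(2) by (rule subset_trans)
    then obtain G'' where G'': "G'' \<in> \<F>" "up M \<subseteq> up G''"
      "\<forall>G'\<in>\<F>. up M \<subseteq> up G' \<and> up G' \<subseteq> up H \<longrightarrow> up G'' \<subseteq> up G'"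
      using sL[OF M H(1)] by blast
    \<comment> \<open>\<open>G\<close> is a candidate below \<open>up H\<close>, which forces
      \<open>up G'' \<subseteq> up G\<close>. So \<open>G''\<close> is a candidate below
      \<open>up F\<close>, and the two upper approximations coincide.\<close>
    have "up G \<subseteq> up H" using G(3) H(2) by (rule subset_trans)
    then have "up G'' \<subseteq> up G" using G''(3) G(1,2) by simp
    then have "up G'' \<subseteq> up F" using G(3) by (rule subset_trans)
    then have "up G \<subseteq> up G''" using G(4) G''(1,2) by simp
    moreover have "up G' \<subseteq> up H" using F'(3) H(3) by (rule subset_trans)
    then have "up G'' \<subseteq> up G'" using G''(3) G' unfolding bounded_cover_def by simp
    ultimately show ?thesis by (rule subset_trans)
  qed
  moreover have "bounded_cover E M G"
    unfolding bounded_cover_def using F(1,3) G(1-3) by blast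
  ultimately have "least_cover E M G"
    unfolding least_cover_def by simp
  then show ?thesis unfolding M_def by blast
qed

lemma principal_ideal_lub_exists:
  assumes E: "closed E" and S: "S \<subseteq> {y. closed y \<and> y \<subseteq> E}"
  shows "\<exists>s. is_lub (inclusion_order {y. closed y \<and> y \<subseteq> E}) s S"
proof -
  \<comment> \<open>Different members of \<A> may lie in different elements of \<open>S\<close>;
    this is how joins of several elements enter.\<close>
  define admissible where "admissible \<A> \<longleftrightarrow> finite \<A> \<and> \<A> \<subseteq> {F \<in> \<F>. \<exists>s\<in>S. F \<subseteq> s}" for \<A>
  define D where "D = {up G | G. \<exists>\<A>. admissible \<A> \<and> least_cover E (\<Union>\<A>) G}"
  have ex: "\<exists>G. least_cover E (\<Union>\<A>) G" if "admissible \<A>" for \<A>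
  proof (rule least_cover_exists[OF E])
    show "finite \<A>" "\<A> \<subseteq> \<F>" "\<Union>\<A> \<subseteq> E"
      using that S unfolding admissible_def by blast+
  qed
  have clD: "closed d" if "d \<in> D" for d
    using that closed_up unfolding D_def least_cover_def bounded_cover_def by blast
  \<comment> \<open>The empty family is admissible even for empty \<open>S\<close>. In that case the
    union of \<open>D\<close> is the bottom of the ideal.\<close>
  have "D \<noteq> {}"
    using ex[of "{}"] unfolding D_def admissible_def by blast
  moreover have "\<forall>x\<in>D. \<forall>y\<in>D. \<exists>z\<in>D. x \<subseteq> z \<and> y \<subseteq> z"
  proof (intro ballI)
    fix x y assume xy: "x \<in> D" "y \<in> D"
    obtain \<A> G \<B> H where "x = up G" "admissible \<A>" "least_cover E (\<Union>\<A>) G"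
      and "y = up H" "admissible \<B>" "least_cover E (\<Union>\<B>) H"
      using xy unfolding D_def by blast
    moreover from this have adm: "admissible (\<A> \<union> \<B>)" unfolding admissible_def by simp
    moreover obtain I where I: "least_cover E (\<Union>(\<A> \<union> \<B>)) I"
      using ex[OF adm] by blast
    ultimately have "x \<subseteq> up I" "y \<subseteq> up I"
      by (auto dest: least_cover_mono[OF _ I])
    then show "\<exists>z\<in>D. x \<subseteq> z \<and> y \<subseteq> z" using adm I unfolding D_def by blast
  qed
  ultimately have "closed (\<Union>D)" using clD closed_directed_Union[of D] by simp
  moreover have "\<Union>D \<subseteq> E"
  proof (rule Union_least)
    fix d assume "d \<in> D"
    then obtain F where "F \<in> \<F>" "F \<subseteq> E" "d \<subseteq> up F"
      unfolding D_def least_cover_def bounded_cover_def by blast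
    then show "d \<subseteq> E" using up_member_subset[OF E] by blast
  qed
  moreover have "s \<subseteq> \<Union>D" if s: "s \<in> S" for s
  proof -
    \<comment> \<open>As \<open>s\<close> is the union of its own approximants, singleton families
      suffice here.\<close>
    have "up F \<subseteq> \<Union>D" if "F \<in> \<F>" "F \<subseteq> s" for F
    proof -
      have adm: "admissible {F}" using that s unfolding admissible_def by blast
      then obtain G where G: "least_cover E (\<Union>{F}) G" using ex by blast
      then have "up F \<subseteq> up G" unfolding least_cover_def bounded_cover_def by simp
      moreover have "up G \<in> D" using adm G unfolding D_def by blast
      ultimately show ?thesis by blast
    qed
    then have "\<Union>{up F | F. F \<in> \<F> \<and> F \<subseteq> s} \<subseteq> \<Union>D" by blast
    moreover have "closed s" using s S by blast
    ultimately show ?thesis by (simp only: Union_approximants)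
  qed
  moreover have "\<Union>D \<subseteq> t" if t: "closed t" "t \<subseteq> E" "\<forall>s\<in>S. s \<subseteq> t" for t
  proof (rule Union_least)
    fix d assume "d \<in> D"
    then obtain \<A> G where \<A>: "admissible \<A>" and G: "least_cover E (\<Union>\<A>) G" "d = up G"
      unfolding D_def by blast
    \<comment> \<open>Approximating this finite set inside \<open>t\<close> gives
      \<open>F \<subseteq> t \<subseteq> E\<close>, a bounded cover with itself as bound; minimality
      of \<open>G\<close> then puts \<open>d\<close> below \<open>up F\<close>, hence inside
      \<open>t\<close>.\<close>
    have "finite (\<Union>\<A>)" "\<Union>\<A> \<subseteq> t"
      using \<A> t finite_member unfolding admissible_def by blast+
    then obtain F where F: "F \<in> \<F>" "\<Union>\<A> \<subseteq> up F" "up F \<subseteq> t" "F \<subseteq> t"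
      using closed_approximate[OF t(1), of "\<Union>\<A>"] by blast
    moreover from this have "F \<subseteq> E" "up (\<Union>\<A>) \<subseteq> up F"
      using t(2) up_least[of "\<Union>\<A>" F] by blast+
    ultimately have "bounded_cover E (\<Union>\<A>) F"
      unfolding bounded_cover_def by blast
    then have "d \<subseteq> up F" using G unfolding least_cover_def by simp
    then show "d \<subseteq> t" using F(3) by (rule subset_trans)
  qed
  ultimately show ?thesis
    by (intro exI[of _ "\<Union>D"]) (subst is_lub_inclusion_iff[OF S], blast)
qed

end

theorem theorem4p16:
  fixes U :: "'a set" and R :: "'a rel" and \<F> :: "'a set set"
  assumes "L_approximation_space U R \<F>"
  shows "L_domain (CF_closed_order U R \<F>)"
proof -
  interpret L_approximation_space U R \<F> by (rule assms)
  show ?thesis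
  proof (intro L_domain.intro L_domain_axioms.intro continuous_domain_closed)
    fix E assume "E \<in> carrier \<CC>"
    then have E: "closed E" by (simp add: carrier_iff)
    have eq: "\<CC>\<lparr>carrier := {y \<in> carrier \<CC>. y \<sqsubseteq>\<^bsub>\<CC>\<^esub> E}\<rparr>
        = inclusion_order {y. closed y \<and> y \<subseteq> E}"
      by (simp add: CF_closed_order_def)
    show "complete_lattice (\<CC>\<lparr>carrier := {y \<in> carrier \<CC>. y \<sqsubseteq>\<^bsub>\<CC>\<^esub> E}\<rparr>)"
      unfolding eq by (intro complete_lattice_inclusionI principal_ideal_lub_exists[OF E])
  qed
qed

end
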